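(* Let $K\ge 2$ and $D\ge 1$ be integers. For real $x$ let $x \bmod 1 \triangleq x-\lfloor x+\tfrac12\rfloor\in[-\tfrac12,\tfrac12)$, applied entrywise to vectors. Let $\mathbf{N}_1,\dots,\mathbf{N}_{K-1}$ be i.i.d. uniform on $[-\tfrac12,\tfrac12)^D$, and let $\mathbf{G}_S\in\mathbb{Z}^{K\times (K-1)}$ be an integer matrix such that any $K-1$ of its rows form a full-rank matrix and $\mathbf{1}_K^\top\mathbf{G}_S=\mathbf{0}^\top$. Define secret keys $(\mathbf{S}_1,\dots,\mathbf{S}_K)$ by $[\mathbf{S}_1;\dots;\mathbf{S}_K]=\mathbf{G}_S[\mathbf{N}_1;\dots;\mathbf{N}_{K-1}] \bmod 1$ (so that $[\sum_k \mathbf{S}_k]\bmod 1=\mathbf{0}$). Let $\mathbf{W}_1,\dots,\mathbf{W}_K\in\mathbb{R}^D$ be random private messages, independent of the keys, with $\mathbf{W}\triangleq\sum_{k=1}^K\mathbf{W}_k\in[-a,a]^D$ for some $0<a<\tfrac12$. Each client $k$ forms $\mathbf{e}_k=[\mathbf{W}_k+\mathbf{S}_k]\bmod 1$ and transmits $\mathbf{x}_k=\frac{\sqrt{P}}{h_k}\mathbf{e}_k$, where $P>0$ is a common power scaling factor and $h_k\in\mathbb{R}\setminus\{0\}$ are fixed channel coefficients. The server receives $\mathbf{y}=\sum_{k=1}^K h_k\mathbf{x}_k+\mathbf{z}=\sqrt{P}\sum_{k=1}^K\mathbf{e}_k+\mathbf{z}$, where $\mathbf{z}\sim\mathcal{N}(\mathbf{0},N_0\mathbf{I}_D)$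 is independent of the messages and keys. Then the server obtains no information about the private messages beyond their sum: $$I\big(\{\mathbf{W}_k\}_{k\in[K]};\mathbf{y}\,\big|\,\mathbf{W}\big)=0.$$
   Context: This is the P$^2$-AirComp protocol: modulo-masked over-the-air computation in which the server estimates the sum as $\hat{\mathbf{W}}=[\mathbf{y}/\sqrt{P}]\bmod 1$. $I(\cdot;\cdot\mid\cdot)$ denotes conditional mutual information. *)

theory Defs
  imports "HOL-Probability.Probability"
begin

definition mod1 :: "real \<Rightarrow> real" where
  "mod1 x = x - real_of_int \<lfloor>x + 1/2\<rfloor>"

definition vmod1 :: "real^'d \<Rightarrow> real^'d" where
  "vmod1 v = (\<chi> j. mod1 (v $ j))"

definition half_cube :: "(real^'d) set" where
  "half_cube = {x. \<forall>j. -1/2 \<le> x $ j \<and> x $ j < 1/2}"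

text \<open>Integer matrix G (rows 1..K, columns 1..K-1): any K-1 of its rows form a
  full-rank (K-1)x(K-1) matrix, i.e. deleting any single row leaves linearly
  independent rows.\<close>
definition any_K1_rows_full_rank :: "nat \<Rightarrow> (nat \<Rightarrow> nat \<Rightarrow> int) \<Rightarrow> bool" where
  "any_K1_rows_full_rank K G \<longleftrightarrow>
     (\<forall>k0\<in>{1..K}. \<forall>c::nat \<Rightarrow> real.
        (\<forall>i\<in>{1..K-1}. (\<Sum>k\<in>{1..K}-{k0}. c k * real_of_int (G k i)) = 0)
        \<longrightarrow> (\<forall>k\<in>{1..K}-{k0}. c k = 0))"

definition indep_rv :: "'a measure \<Rightarrow> 'b measure \<Rightarrow> ('a \<Rightarrow> 'b) \<Rightarrow> 'c measure \<Rightarrow> ('a \<Rightarrow> 'c) \<Rightarrow> bool" where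
  "indep_rv M MA X MB Y \<longleftrightarrow> X \<in> measurable M MA \<and> Y \<in> measurable M MB \<and>
     prob_space.indep_set M (sets (vimage_algebra (space M) X MA)) (sets (vimage_algebra (space M) Y MB))"

end

theory Submission
  imports Defs
begin

text \<open>
  Fix a message vector v. If v and v' have the same sum, then v - v' lies in the real column space
  of G, say v - v' = G t. Since G is integral, adding v to the keys G N mod 1 is the same as
  adding v' to the keys built from N + t mod 1, and N + t mod 1 has the same law as N. Hence the
  conditional law of y given the messages depends on their sum W only. The Gaussian noise gives
  this law a strictly positive Lebesgue density g(y, W), so the density of the joint law of
  (y, messages, W) with respect to the product of its marginals is a function of (y, W). Both
  mutual informations are then the integral of the logarithm of that same function; no
  integrability is needed for them to agree.
\<close>

section \<open>Conditional mutual information and sufficient statistics\<close>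

text \<open>The density depends on a point only through \<open>T\<close>, so \<open>T\<close> is a
  sufficient statistic and no divergence is lost. Uniqueness of the Radon-Nikodym derivative
  identifies it as \<open>D (T x)\<close> before and as \<open>D\<close> after the push-forward, and
  the change of variables matches the two integrals, integrable or not.\<close>

lemma KL_divergence_density_distr:
  assumes P: "prob_space P" and Q: "prob_space (density P (\<lambda>x. D (T x)))"
    and [measurable]: "T \<in> P \<rightarrow>\<^sub>M R" "D \<in> borel_measurable R"
  shows "KL_divergence b P (density P (\<lambda>x. D (T x))) =
    KL_divergence b (distr P R T) (distr (density P (\<lambda>x. D (T x))) R T)"
proof -
  interpret P: prob_space P by fact
  interpret Q: prob_space "density P (\<lambda>x. D (T x))" by fact
  interpret PT: prob_space "distr P R T" by (rule P.prob_space_distr) simp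
  interpret QT: prob_space "distr (density P (\<lambda>x. D (T x))) R T" by (rule Q.prob_space_distr) simp
  have QT: "distr (density P (\<lambda>x. D (T x))) R T = density (distr P R T) D"
    by (rule density_distr[symmetric]) auto
  have 1: "AE x in P. D (T x) = RN_deriv P (density P (\<lambda>x. D (T x))) x"
    by (rule P.RN_deriv_unique) auto
  have 2: "AE x in distr P R T. D x = RN_deriv (distr P R T) (density (distr P R T) D) x"
    by (rule PT.RN_deriv_unique) auto
  have "KL_divergence b P (density P (\<lambda>x. D (T x))) =
      (\<integral>x. log b (enn2real (D (T x))) \<partial>density P (\<lambda>x. D (T x)))"
    unfolding KL_divergence_def entropy_density_def comp_def
    using 1 by (intro integral_cong_AE) (auto simp: AE_density)
  also have "\<dots> = (\<integral>x. log b (enn2real (D x)) \<partial>density (distr P R T) D)"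
    unfolding QT[symmetric] by (subst integral_distr) auto
  also have "\<dots> = KL_divergence b (distr P R T) (density (distr P R T) D)"
    unfolding KL_divergence_def entropy_density_def comp_def
    using 2 by (intro integral_cong_AE) (auto simp: AE_density)
  finally show ?thesis unfolding QT .
qed

text \<open>Hypothesis \<open>XYZ\<close> is a Markov condition: given \<open>Y\<close> and
  \<open>Z\<close>, the variable \<open>X\<close> has a density with respect to \<open>\<mu>\<close>
  that ignores the value of \<open>Y\<close>. The conditional mutual information is by definition
  I(X; (Y, Z)) - I(X; Z), and both terms are divergences with the same density.\<close>

lemma (in prob_space) conditional_mutual_information_eq_0:
  fixes T :: "'c measure" and g :: "'b \<Rightarrow> 'd \<Rightarrow> ennreal"
  assumes [measurable]: "X \<in> M \<rightarrow>\<^sub>M S" "Y \<in> M \<rightarrow>\<^sub>M T" "Z \<in> M \<rightarrow>\<^sub>M U"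
    and \<mu>: "sigma_finite_measure \<mu>" and sets_\<mu>[measurable_cong]: "sets \<mu> = sets S"
    and g[measurable]: "case_prod g \<in> borel_measurable (S \<Otimes>\<^sub>M U)"
    and g_pos: "\<And>x z. x \<in> space S \<Longrightarrow> z \<in> space U \<Longrightarrow> g x z > 0"
    and XYZ: "distr M (S \<Otimes>\<^sub>M (T \<Otimes>\<^sub>M U)) (\<lambda>\<omega>. (X \<omega>, Y \<omega>, Z \<omega>)) =
      density (\<mu> \<Otimes>\<^sub>M distr M (T \<Otimes>\<^sub>M U) (\<lambda>\<omega>. (Y \<omega>, Z \<omega>))) (\<lambda>(x, y, z). g x z)"
  shows "conditional_mutual_information b S T U X Y Z = 0"
proof -
  define YZ where "YZ = distr M (T \<Otimes>\<^sub>M U) (\<lambda>\<omega>. (Y \<omega>, Z \<omega>))"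
  define LX where "LX = distr M S X"
  define Q where "Q = distr M (S \<Otimes>\<^sub>M (T \<Otimes>\<^sub>M U)) (\<lambda>\<omega>. (X \<omega>, Y \<omega>, Z \<omega>))"
  \<comment> \<open>\<open>f\<close> is the marginal density of \<open>X\<close> with respect to
    \<open>\<mu>\<close>, so \<open>D\<close> is the density of the joint law relative to the
    product of the marginals. It factors through \<open>pr\<close>, which forgets
    \<open>y\<close>.\<close>
  define f where "f x = (\<integral>\<^sup>+u. g x (snd u) \<partial>YZ)" for x
  define D where "D = (\<lambda>(x, z). g x z / f x)"
  define pr where "pr = (\<lambda>(x :: 'b, y :: 'c, z :: 'd). (x, z))"
  have [measurable_cong]: "sets YZ = sets (T \<Otimes>\<^sub>M U)" "sets LX = sets S"
      "sets Q = sets (S \<Otimes>\<^sub>M (T \<Otimes>\<^sub>M U))"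
    by (simp_all add: YZ_def LX_def Q_def)
  have pr[measurable]: "pr \<in> (S \<Otimes>\<^sub>M (T \<Otimes>\<^sub>M U)) \<rightarrow>\<^sub>M (S \<Otimes>\<^sub>M U)"
    unfolding pr_def by measurable
  interpret \<mu>: sigma_finite_measure \<mu> by fact
  interpret YZ: prob_space YZ unfolding YZ_def by (rule prob_space_distr) simp
  interpret LX: prob_space LX unfolding LX_def by (rule prob_space_distr) simp
  interpret Q: prob_space Q unfolding Q_def by (rule prob_space_distr) simp
  interpret pair_sigma_finite \<mu> YZ ..
  interpret P: pair_prob_space LX YZ ..
  have f[measurable]: "f \<in> borel_measurable S"
    unfolding f_def by measurable
  have D[measurable]: "D \<in> borel_measurable (S \<Otimes>\<^sub>M U)"
    unfolding D_def by measurable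
  have Q_eq: "Q = density (\<mu> \<Otimes>\<^sub>M YZ) (\<lambda>(x, y, z). g x z)"
    using XYZ by (simp add: Q_def YZ_def)
  have LX_eq: "LX = density \<mu> f"
  proof (rule measure_eqI)
    fix A assume "A \<in> sets LX"
    then have A[measurable]: "A \<in> sets S" by (simp add: LX_def)
    have "emeasure LX A = emeasure Q (A \<times> space (T \<Otimes>\<^sub>M U))"
    proof -
      have "LX = distr Q S fst"
        unfolding LX_def Q_def by (subst distr_distr) (auto simp: comp_def)
      then have "emeasure LX A = emeasure Q (fst -` A \<inter> space Q)"
        by (simp add: emeasure_distr)
      also have "fst -` A \<inter> space Q = A \<times> space (T \<Otimes>\<^sub>M U)"
        using sets.sets_into_space[OF A] by (auto simp: Q_def space_pair_measure)
      finally show ?thesis .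
    qed
    also have "\<dots> = (\<integral>\<^sup>+p. (case p of (x, y, z) \<Rightarrow> g x z) * indicator (A \<times> space (T \<Otimes>\<^sub>M U)) p \<partial>(\<mu> \<Otimes>\<^sub>M YZ))"
      unfolding Q_eq by (rule emeasure_density) auto
    also have "\<dots> = (\<integral>\<^sup>+x. \<integral>\<^sup>+u. (case u of (y, z) \<Rightarrow> g x z) * indicator (A \<times> space (T \<Otimes>\<^sub>M U)) (x, u) \<partial>YZ \<partial>\<mu>)"
      by (subst YZ.nn_integral_fst[symmetric]) auto
    also have "\<dots> = (\<integral>\<^sup>+x. \<integral>\<^sup>+u. g x (snd u) * indicator A x \<partial>YZ \<partial>\<mu>)"
      by (intro nn_integral_cong) (auto simp: indicator_def YZ_def split: prod.splits)
    also have "\<dots> = (\<integral>\<^sup>+x. f x * indicator A x \<partial>\<mu>)"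
      unfolding f_def by (intro nn_integral_cong nn_integral_multc) (auto simp: sets_eq_imp_space_eq[OF sets_\<mu>])
    also have "\<dots> = emeasure (density \<mu> f) A"
      by (rule emeasure_density[symmetric]) auto
    finally show "emeasure LX A = emeasure (density \<mu> f) A" .
  qed (simp add: LX_def sets_\<mu>)
  \<comment> \<open>Cancelling the quotient in \<open>D\<close> within \<open>ennreal\<close> needs
    \<open>f\<close> to be neither 0 nor infinite. It is nonzero because a positive function has a
    nonzero integral under a probability measure.\<close>
  have f_pos: "f x \<noteq> 0" if "x \<in> space S" for x
  proof
    assume "f x = 0"
    then have "AE u in YZ. g x (snd u) = 0"
      using that unfolding f_def by (subst (asm) nn_integral_0_iff_AE) auto
    then have "AE u in YZ. False"
      using AE_space
      by eventually_elim (use g_pos[OF that] in \<open>force simp: YZ_def space_pair_measure\<close>)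
    then show False by simp
  qed
  have "(\<integral>\<^sup>+x. f x \<partial>\<mu>) = emeasure LX (space LX)"
    by (simp add: LX_eq emeasure_density cong: nn_integral_cong)
  \<comment> \<open>The total mass of \<open>f\<close> is 1, which gives finiteness almost
    everywhere.\<close>
  then have "AE x in \<mu>. f x \<noteq> \<infinity>"
    by (intro nn_integral_noteq_infinite) (auto simp: LX.emeasure_space_1)
  then have f_fin: "AE p in \<mu> \<Otimes>\<^sub>M YZ. f (fst p) \<noteq> \<infinity>"
    by (intro AE_pair_measure) auto
  have prodP: "LX \<Otimes>\<^sub>M YZ = density (\<mu> \<Otimes>\<^sub>M YZ) (\<lambda>p. f (fst p))"
    using pair_measure_density[of f \<mu> "\<lambda>_. 1" YZ] YZ.sigma_finite_measure_axioms
    by (simp add: LX_eq density_1 case_prod_unfold)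
  have Q_dens: "Q = density (LX \<Otimes>\<^sub>M YZ) (\<lambda>p. D (pr p))"
  proof -
    have "density (LX \<Otimes>\<^sub>M YZ) (\<lambda>p. D (pr p)) = density (\<mu> \<Otimes>\<^sub>M YZ) (\<lambda>p. f (fst p) * D (pr p))"
      unfolding prodP by (rule density_density_eq) auto
    also have "\<dots> = density (\<mu> \<Otimes>\<^sub>M YZ) (\<lambda>(x, y, z). g x z)"
    proof (rule density_cong)
      show "AE p in \<mu> \<Otimes>\<^sub>M YZ. f (fst p) * D (pr p) = (case p of (x, y, z) \<Rightarrow> g x z)"
        using f_fin AE_space
      proof eventually_elim
        case (elim p)
        then have "fst p \<in> space S" by (auto simp: space_pair_measure sets_eq_imp_space_eq[OF sets_\<mu>])
        from f_pos[OF this] elim have "f (fst p) * c / f (fst p) = c" for c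
          by (subst mult.commute) (simp add: mult_divide_eq_ennreal)
        then show ?case
          by (cases p) (simp add: D_def pr_def ennreal_times_divide)
      qed
    qed auto
    finally show ?thesis by (simp add: Q_eq)
  qed
  have 1: "mutual_information b S (T \<Otimes>\<^sub>M U) X (\<lambda>\<omega>. (Y \<omega>, Z \<omega>)) = KL_divergence b (LX \<Otimes>\<^sub>M YZ) Q"
    by (simp add: mutual_information_def LX_def YZ_def Q_def)
  \<comment> \<open>Forgetting \<open>y\<close> turns the product of the laws of \<open>X\<close>
    and \<open>(Y, Z)\<close> into the reference measure of I(X; Z).\<close>
  have "distr (LX \<Otimes>\<^sub>M YZ) (S \<Otimes>\<^sub>M U) pr = LX \<Otimes>\<^sub>M distr M U Z"
  proof -
    have Z: "distr M U Z = distr YZ U snd"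
      unfolding YZ_def by (subst distr_distr) (auto simp: comp_def)
    interpret Z: prob_space "distr YZ U snd" by (rule YZ.prob_space_distr) simp
    have "LX \<Otimes>\<^sub>M distr YZ U snd = distr LX S (\<lambda>x. x) \<Otimes>\<^sub>M distr YZ U snd"
      by (subst distr_id2) (simp_all add: LX_def)
    also have "\<dots> = distr (LX \<Otimes>\<^sub>M YZ) (S \<Otimes>\<^sub>M U) (\<lambda>(x, u). (x, snd u))"
      by (rule pair_measure_distr) (auto simp: Z.sigma_finite_measure_axioms)
    also have "(\<lambda>(x, u). (x, snd u)) = pr" by (auto simp: pr_def)
    finally show ?thesis by (simp add: Z)
  qed
  moreover have "distr Q (S \<Otimes>\<^sub>M U) pr = distr M (S \<Otimes>\<^sub>M U) (\<lambda>\<omega>. (X \<omega>, Z \<omega>))"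
    unfolding Q_def by (subst distr_distr) (auto simp: comp_def pr_def)
  ultimately have 2: "mutual_information b S U X Z =
      KL_divergence b (distr (LX \<Otimes>\<^sub>M YZ) (S \<Otimes>\<^sub>M U) pr) (distr Q (S \<Otimes>\<^sub>M U) pr)"
    by (simp add: mutual_information_def LX_def)
  have "KL_divergence b (LX \<Otimes>\<^sub>M YZ) Q =
      KL_divergence b (distr (LX \<Otimes>\<^sub>M YZ) (S \<Otimes>\<^sub>M U) pr) (distr Q (S \<Otimes>\<^sub>M U) pr)"
    using KL_divergence_density_distr[OF P.prob_space_axioms, of D pr "S \<Otimes>\<^sub>M U" b] Q.prob_space_axioms
    unfolding Q_dens[symmetric] by simp
  then show ?thesis
    unfolding conditional_mutual_information_def 1 2 by simp
qed

section \<open>The column space of the key matrix\<close>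

text \<open>Induction on the rows, which are linearly independent by the last hypothesis: a vector
  killed by the old rows but not by the new one corrects an old solution without disturbing the old
  equations.\<close>

lemma linear_system_solvable:
  fixes A :: "'i \<Rightarrow> 'j \<Rightarrow> real"
  assumes "finite I" "finite J"
    and "\<And>c. (\<forall>j\<in>J. (\<Sum>i\<in>I. c i * A i j) = 0) \<Longrightarrow> \<forall>i\<in>I. c i = 0"
  shows "\<exists>t. \<forall>i\<in>I. (\<Sum>j\<in>J. A i j * t j) = u i"
  using assms(1,3)
proof (induction I arbitrary: u rule: finite_induct)
  case (insert k I)
  \<comment> \<open>A relation among the rows in \<open>I\<close> is padded with coefficient 0 at
    \<open>k\<close>.\<close>
  have ker: "\<forall>i\<in>I. c i = 0" if c: "\<forall>j\<in>J. (\<Sum>i\<in>I. c i * A i j) = 0" for c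
  proof -
    have "(\<Sum>i\<in>I. (c(k := 0)) i * A i j) = (\<Sum>i\<in>I. c i * A i j)" for j
      using insert.hyps by (intro sum.cong) auto
    with c have "\<forall>i\<in>insert k I. (c(k := 0)) i = 0"
      using insert.hyps by (intro insert.prems) auto
    with insert.hyps show ?thesis by (metis fun_upd_apply insertCI)
  qed
  have IH: "\<exists>t. \<forall>i\<in>I. (\<Sum>j\<in>J. A i j * t j) = u i" for u
    by (rule insert.IH) (use ker in blast)
  \<comment> \<open>Otherwise row k would vanish on the common kernel of the rows in I and hence be a
    combination of them.\<close>
  have "\<exists>t. (\<forall>i\<in>I. (\<Sum>j\<in>J. A i j * t j) = 0) \<and> (\<Sum>j\<in>J. A k j * t j) \<noteq> 0"
  proof (rule ccontr)
    assume "\<not> ?thesis"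
    then have vanish: "(\<Sum>j\<in>J. A k j * t j) = 0" if "\<forall>i\<in>I. (\<Sum>j\<in>J. A i j * t j) = 0" for t
      using that by blast
    \<comment> \<open>The vectors \<open>b l\<close> obtained here are dual to the rows in
      \<open>I\<close>.\<close>
    from IH have "\<forall>l. \<exists>t. \<forall>i\<in>I. (\<Sum>j\<in>J. A i j * t j) = (if i = l then 1 else 0)" by auto
    then obtain b where b: "\<And>l i. i \<in> I \<Longrightarrow> (\<Sum>j\<in>J. A i j * b l j) = (if i = l then 1 else 0)"
      by metis
    define c where "c l = (\<Sum>j\<in>J. A k j * b l j)" for l
    have row: "A k m = (\<Sum>l\<in>I. c l * A l m)" if "m \<in> J" for m
    proof -
      \<comment> \<open>The \<open>m\<close>-th unit vector, corrected by the dual vectors so as to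
        lie in the common kernel of the rows in \<open>I\<close>. Evaluating row \<open>k\<close> on
        it isolates the entry \<open>A k m\<close>.\<close>
      define t where "t j = (if j = m then 1 else 0) - (\<Sum>l\<in>I. A l m * b l j)" for j
      have t: "(\<Sum>j\<in>J. A i j * t j) = A i m - (\<Sum>l\<in>I. A l m * (\<Sum>j\<in>J. A i j * b l j))" for i
      proof -
        have "(\<Sum>j\<in>J. A i j * t j) = (\<Sum>j\<in>J. A i j * (if j = m then 1 else 0)) -
            (\<Sum>j\<in>J. \<Sum>l\<in>I. A l m * (A i j * b l j))"
          by (simp add: t_def right_diff_distrib sum_subtractf sum_distrib_left mult_ac)
        also have "(\<Sum>j\<in>J. A i j * (if j = m then 1 else 0)) = A i m"
          using \<open>m \<in> J\<close> \<open>finite J\<close> by (simp add: if_distrib cong: if_cong)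
        also have "(\<Sum>j\<in>J. \<Sum>l\<in>I. A l m * (A i j * b l j)) = (\<Sum>l\<in>I. A l m * (\<Sum>j\<in>J. A i j * b l j))"
          by (subst sum.swap) (simp add: sum_distrib_left)
        finally show ?thesis .
      qed
      have "(\<Sum>j\<in>J. A i j * t j) = 0" if "i \<in> I" for i
        unfolding t using that insert.hyps by (simp add: b if_distrib cong: if_cong)
      then have "(\<Sum>j\<in>J. A k j * t j) = 0" by (intro vanish) blast
      then show ?thesis unfolding t by (simp add: c_def mult.commute)
    qed
    have "(\<Sum>i\<in>insert k I. (c(k := -1)) i * A i j) = 0" if "j \<in> J" for j
    proof -
      have "(\<Sum>i\<in>I. (c(k := -1)) i * A i j) = (\<Sum>i\<in>I. c i * A i j)"
        using insert.hyps by (intro sum.cong) auto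
      then show ?thesis using insert.hyps row[OF that] by simp
    qed
    then have "\<forall>i\<in>insert k I. (c(k := -1)) i = 0" by (intro insert.prems) blast
    then show False by simp
  qed
  then obtain s where s: "\<And>i. i \<in> I \<Longrightarrow> (\<Sum>j\<in>J. A i j * s j) = 0" "(\<Sum>j\<in>J. A k j * s j) \<noteq> 0" by blast
  from IH obtain t where t: "\<And>i. i \<in> I \<Longrightarrow> (\<Sum>j\<in>J. A i j * t j) = u i" by blast
  \<comment> \<open>The multiple of \<open>s\<close> that repairs the equation of row
    \<open>k\<close>.\<close>
  define r where "r = (u k - (\<Sum>j\<in>J. A k j * t j)) / (\<Sum>j\<in>J. A k j * s j)"
  have lin: "(\<Sum>j\<in>J. A i j * (t j + r * s j)) = (\<Sum>j\<in>J. A i j * t j) + r * (\<Sum>j\<in>J. A i j * s j)" for i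
    by (simp add: distrib_left sum.distrib sum_distrib_left mult_ac)
  have "r * (\<Sum>j\<in>J. A k j * s j) = u k - (\<Sum>j\<in>J. A k j * t j)"
    using s(2) by (simp add: r_def)
  then show ?case
    by (intro exI[of _ "\<lambda>j. t j + r * s j"]) (use s(1) t in \<open>auto simp: lin\<close>)
qed simp

text \<open>Deleting row \<open>K\<close> leaves independent rows, so the other equations are
  solvable coordinate by coordinate. The equation of row \<open>K\<close> then follows, because the
  columns of \<open>G\<close> and the vectors \<open>u k\<close> both sum to 0.\<close>

lemma sum_zero_in_column_space:
  fixes u :: "nat \<Rightarrow> real^'d"
  assumes K: "K \<ge> 1" and G: "any_K1_rows_full_rank K G"
    and G_colsum: "\<forall>i\<in>{1..K-1}. (\<Sum>k=1..K. G k i) = 0"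
    and u: "(\<Sum>k=1..K. u k) = 0"
  shows "\<exists>t. \<forall>k\<in>{1..K}. (\<Sum>i=1..K-1. real_of_int (G k i) *\<^sub>R t i) = u k"
proof -
  have split: "{1..K} = insert K ({1..K} - {K})" using K by auto
  have "\<exists>t. \<forall>k\<in>{1..K} - {K}. (\<Sum>i=1..K-1. real_of_int (G k i) * t i) = u k $ j" for j
  proof (rule linear_system_solvable)
    fix c assume "\<forall>i\<in>{1..K-1}. (\<Sum>k\<in>{1..K} - {K}. c k * real_of_int (G k i)) = 0"
    moreover have "K \<in> {1..K}" using K by simp
    ultimately show "\<forall>k\<in>{1..K} - {K}. c k = 0"
      using G unfolding any_K1_rows_full_rank_def by blast
  qed auto
  then obtain t where t: "\<And>j k. k \<in> {1..K} - {K} \<Longrightarrow> (\<Sum>i=1..K-1. real_of_int (G k i) * t j i) = u k $ j"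
    by metis
  define s where "s i = (\<chi> j. t j i)" for i
  define r where "r k = (\<Sum>i=1..K-1. real_of_int (G k i) *\<^sub>R s i)" for k
  have r: "r k = u k" if "k \<in> {1..K} - {K}" for k
    using t[OF that] by (simp add: r_def s_def vec_eq_iff)
  have "(\<Sum>k=1..K. r k) = (\<Sum>i=1..K-1. \<Sum>k=1..K. real_of_int (G k i) *\<^sub>R s i)"
    unfolding r_def by (rule sum.swap)
  also have "\<dots> = (\<Sum>i=1..K-1. real_of_int (\<Sum>k=1..K. G k i) *\<^sub>R s i)"
    by (simp add: scaleR_sum_left)
  also have "\<dots> = 0" using G_colsum by (intro sum.neutral) simp
  finally have "r K + (\<Sum>k\<in>{1..K} - {K}. r k) = 0"
    by (subst (asm) split, subst (asm) sum.insert) auto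
  moreover have "u K + (\<Sum>k\<in>{1..K} - {K}. u k) = 0"
    using u by (subst (asm) split, subst (asm) sum.insert) auto
  moreover have "(\<Sum>k\<in>{1..K} - {K}. r k) = (\<Sum>k\<in>{1..K} - {K}. u k)"
    using r by (rule sum.cong[OF refl])
  ultimately have "r K = u K" by (simp add: eq_neg_iff_add_eq_0[symmetric])
  with r have "\<forall>k\<in>{1..K}. r k = u k" by (metis DiffI singletonD)
  then show ?thesis unfolding r_def by blast
qed

section \<open>Reduction modulo the integer lattice\<close>

lemma mod1_cong_Ints:
  assumes "x - y \<in> \<int>"
  shows "mod1 x = mod1 y"
proof -
  from assms obtain n where "x = y + of_int n" by (metis Ints_cases diff_add_cancel add.commute)
  moreover have "\<lfloor>y + of_int n + 1/2\<rfloor> = \<lfloor>y + 1/2\<rfloor> + n"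
    by (metis add.commute add.left_commute floor_add_int)
  ultimately show ?thesis by (simp add: mod1_def)
qed

lemma mod1_diff_Ints: "mod1 x - x \<in> \<int>"
  by (simp add: mod1_def)

lemma mod1_bounds: "-1/2 \<le> mod1 x" "mod1 x < 1/2"
  unfolding mod1_def by linarith+

lemma mod1_id:
  assumes "-1/2 \<le> x" "x < 1/2"
  shows "mod1 x = x"
proof -
  have "\<lfloor>x + 1/2\<rfloor> = 0" using assms by linarith
  then show ?thesis by (simp add: mod1_def)
qed

lemma vmod1_cong_Ints: "(\<And>j. x $ j - y $ j \<in> \<int>) \<Longrightarrow> vmod1 x = vmod1 y"
  by (simp add: vmod1_def vec_eq_iff mod1_cong_Ints)

lemma vmod1_diff_Ints: "vmod1 x $ j - x $ j \<in> \<int>"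
  by (simp add: vmod1_def mod1_diff_Ints)

lemma vmod1_in_half_cube: "vmod1 x \<in> half_cube"
  using mod1_bounds by (simp add: half_cube_def vmod1_def)

lemma vmod1_id: "x \<in> half_cube \<Longrightarrow> vmod1 x = x"
  by (simp add: half_cube_def vmod1_def vec_eq_iff mod1_id)

lemma borel_measurable_vec_nth [measurable]:
  "(\<lambda>x :: real^'d. x $ j) \<in> borel_measurable borel"
  by (intro borel_measurable_continuous_onI continuous_intros)

lemma borel_measurable_vmod1 [measurable]: "vmod1 \<in> borel_measurable borel"
proof (subst borel_measurable_euclidean_space, intro ballI)
  fix i :: "real^'d" assume "i \<in> Basis"
  then obtain j where "i = axis j 1" by (auto simp: Basis_vec_def)
  then have "(\<lambda>x. vmod1 x \<bullet> i) = (\<lambda>x. x $ j - real_of_int \<lfloor>x $ j + 1/2\<rfloor>)"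
    by (simp add: vmod1_def mod1_def inner_axis fun_eq_iff)
  then show "(\<lambda>x. vmod1 x \<bullet> i) \<in> borel_measurable borel" by simp
qed

lemma half_cube_sets [measurable]: "half_cube \<in> sets borel"
proof -
  have "(half_cube :: (real^'d) set) = {x \<in> space borel. \<forall>j. -1/2 \<le> x $ j \<and> x $ j < 1/2}"
    by (simp add: half_cube_def)
  also have "\<dots> \<in> sets borel" by measurable
  finally show ?thesis .
qed

text \<open>The lattice is parametrised by a countable type, so that the cube can be cut into
  countably many cells indexed by it.\<close>

definition int_vec :: "int^'d \<Rightarrow> real^'d" where
  "int_vec m = (\<chi> j. real_of_int (m $ j))"

text \<open>The half-open cube is a fundamental domain of the integer lattice. In this form a
  preimage under \<open>vmod1\<close> becomes a union of lattice translates.\<close>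

lemma vmod1_eq_iff: "vmod1 x = y \<longleftrightarrow> y \<in> half_cube \<and> (\<exists>m. x - int_vec m = y)"
proof safe
  show "vmod1 x \<in> half_cube" by (rule vmod1_in_half_cube)
  have "x - int_vec (\<chi> j. \<lfloor>x $ j + 1/2\<rfloor>) = vmod1 x"
    by (simp add: vec_eq_iff int_vec_def vmod1_def mod1_def)
  then show "\<exists>m. x - int_vec m = vmod1 x" ..
next
  fix m assume "x - int_vec m \<in> half_cube"
  moreover have "vmod1 x = vmod1 (x - int_vec m)"
    by (rule vmod1_cong_Ints) (simp add: int_vec_def)
  ultimately show "vmod1 x = x - int_vec m" by (simp add: vmod1_id)
qed

lemma inj_int_vec: "int_vec m = int_vec n \<Longrightarrow> m = n"
  by (simp add: int_vec_def vec_eq_iff)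

section \<open>Invariance of the uniform law under shifts modulo 1\<close>

lemma emeasure_lborel_translation:
  fixes A :: "'a::euclidean_space set"
  assumes [measurable]: "A \<in> sets borel"
  shows "emeasure lborel {x. c + x \<in> A} = emeasure lborel A"
proof -
  have "emeasure lborel A = emeasure (distr lborel borel ((+) c)) A"
    by (simp add: lborel_distr_plus)
  also have "\<dots> = emeasure lborel {x. c + x \<in> A}"
    by (subst emeasure_distr) (auto simp: vimage_def)
  finally show ?thesis by simp
qed

text \<open>Cut the cube along the lattice translates of the shifted cube; the pieces are permuted by
  translations, which preserve Lebesgue measure.\<close>

lemma emeasure_half_cube_vmod1_shift:
  fixes A :: "(real^'d) set"
  assumes [measurable]: "A \<in> sets borel"
  shows "emeasure lborel (half_cube \<inter> {x. vmod1 (t + x) \<in> A}) = emeasure lborel (half_cube \<inter> A)"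
proof -
  \<comment> \<open>\<open>E m\<close> consists of the target points reached from the cube by the
    single translation by \<open>t - int_vec m\<close>; \<open>B m\<close> is its preimage under
    that translation.\<close>
  define E where "E m = {y \<in> half_cube \<inter> A. y - t + int_vec m \<in> half_cube}" for m :: "int^'d"
  define B where "B m = {x. (t - int_vec m) + x \<in> E m}" for m
  have E[measurable]: "E m \<in> sets borel" for m
    unfolding E_def by measurable
  have B[measurable]: "B m \<in> sets borel" for m
    unfolding B_def by measurable
  have B_iff: "x \<in> B m \<longleftrightarrow> x \<in> half_cube \<and> t + x - int_vec m \<in> half_cube \<and> t + x - int_vec m \<in> A" for x m
    by (auto simp: B_def E_def algebra_simps)
  have UB: "half_cube \<inter> {x. vmod1 (t + x) \<in> A} = (\<Union>m\<in>UNIV. B m)"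
  proof -
    have "vmod1 (t + x) \<in> A \<longleftrightarrow> (\<exists>m. t + x - int_vec m \<in> half_cube \<and> t + x - int_vec m \<in> A)" for x
    proof -
      have "vmod1 (t + x) \<in> A \<longleftrightarrow> (\<exists>y. vmod1 (t + x) = y \<and> y \<in> A)" by simp
      then show ?thesis unfolding vmod1_eq_iff by blast
    qed
    then show ?thesis by (auto simp: B_iff)
  qed
  have UE: "half_cube \<inter> A = (\<Union>m\<in>UNIV. E m)"
  proof -
    have "\<exists>m. y - t + int_vec m \<in> half_cube" for y
    proof -
      \<comment> \<open>Reduction subtracts a lattice vector whereas \<open>E\<close> adds one,
        hence the witness \<open>- m\<close>.\<close>
      obtain m where "y - t - int_vec m = vmod1 (y - t)"
        using vmod1_eq_iff[of "y - t" "vmod1 (y - t)"] by blast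
      moreover have "int_vec (- m) = - int_vec m" by (simp add: int_vec_def vec_eq_iff)
      ultimately have "y - t + int_vec (- m) \<in> half_cube"
        using vmod1_in_half_cube[of "y - t"] by simp
      then show ?thesis ..
    qed
    then show ?thesis by (auto simp: E_def)
  qed
  have dB: "disjoint_family_on B UNIV"
    unfolding disjoint_family_on_def
  proof (intro ballI impI equals0I)
    fix m n x assume "m \<noteq> n" "x \<in> B m \<inter> B n"
    then have "vmod1 (t + x) = t + x - int_vec m" "vmod1 (t + x) = t + x - int_vec n"
      by (auto simp: B_iff vmod1_eq_iff)
    then have "int_vec m = int_vec n" by simp
    with inj_int_vec \<open>m \<noteq> n\<close> show False by blast
  qed
  have dE: "disjoint_family_on E UNIV"
    unfolding disjoint_family_on_def
  proof (intro ballI impI equals0I)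
    fix m n y assume "m \<noteq> n" "y \<in> E m \<inter> E n"
    then have "y - t + int_vec m = vmod1 (y - t + int_vec m)" "y - t + int_vec n = vmod1 (y - t + int_vec n)"
      by (auto simp: E_def vmod1_id)
    moreover have "vmod1 (y - t + int_vec m) = vmod1 (y - t + int_vec n)"
      by (rule vmod1_cong_Ints) (simp add: int_vec_def)
    ultimately have "int_vec m = int_vec n" by (metis add_left_cancel)
    with inj_int_vec \<open>m \<noteq> n\<close> show False by blast
  qed
  have "emeasure lborel (half_cube \<inter> {x. vmod1 (t + x) \<in> A}) = (\<integral>\<^sup>+m. emeasure lborel (B m) \<partial>count_space UNIV)"
    unfolding UB by (rule emeasure_UN_countable) (auto simp: dB)
  also have "\<dots> = (\<integral>\<^sup>+m. emeasure lborel (E m) \<partial>count_space UNIV)"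
    unfolding B_def by (simp add: emeasure_lborel_translation)
  also have "\<dots> = emeasure lborel (half_cube \<inter> A)"
    unfolding UE by (rule emeasure_UN_countable[symmetric]) (auto simp: dE)
  finally show ?thesis .
qed

text \<open>The cube with addition modulo 1 is a torus, and its uniform law is the Haar
  measure.\<close>

lemma distr_uniform_half_cube_vmod1_shift:
  "distr (uniform_measure lborel half_cube) borel (\<lambda>x. vmod1 (t + x)) =
    uniform_measure lborel (half_cube :: (real^'d) set)"
proof (rule measure_eqI)
  fix A assume "A \<in> sets (distr (uniform_measure lborel half_cube) borel (\<lambda>x :: real^'d. vmod1 (t + x)))"
  then have [measurable]: "A \<in> sets borel" by simp
  have "emeasure (distr (uniform_measure lborel half_cube) borel (\<lambda>x. vmod1 (t + x))) A
      = emeasure (uniform_measure lborel half_cube) {x. vmod1 (t + x) \<in> A}"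
    by (subst emeasure_distr) (auto simp: vimage_def)
  also have "\<dots> = emeasure (uniform_measure lborel half_cube) A"
    by (simp add: emeasure_half_cube_vmod1_shift)
  finally show "emeasure (distr (uniform_measure lborel half_cube) borel (\<lambda>x. vmod1 (t + x))) A
      = emeasure (uniform_measure lborel half_cube) A" .
qed simp

text \<open>Independence survives coordinatewise shifts, so both joint laws are products, and each
  factor is shift invariant.\<close>

lemma (in prob_space) distr_indep_uniform_vmod1_shift:
  fixes N :: "'i \<Rightarrow> 'a \<Rightarrow> real^'d"
  assumes I: "I \<noteq> {}" and indep: "indep_vars (\<lambda>_. borel) N I"
    and unif: "\<And>i. i \<in> I \<Longrightarrow> distr M borel (N i) = uniform_measure lborel half_cube"
  shows "distr M (PiM I (\<lambda>_. borel)) (\<lambda>\<omega>. \<lambda>i\<in>I. vmod1 (t i + N i \<omega>)) =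
    distr M (PiM I (\<lambda>_. borel)) (\<lambda>\<omega>. \<lambda>i\<in>I. N i \<omega>)"
proof -
  have N[measurable]: "N i \<in> borel_measurable M" if "i \<in> I" for i
    using indep that by (auto simp: indep_vars_def)
  have "indep_vars (\<lambda>_. borel) (\<lambda>i \<omega>. vmod1 (t i + N i \<omega>)) I"
    by (rule indep_vars_compose2[OF indep]) measurable
  then have "distr M (PiM I (\<lambda>_. borel)) (\<lambda>\<omega>. \<lambda>i\<in>I. vmod1 (t i + N i \<omega>)) =
      (\<Pi>\<^sub>M i\<in>I. distr M borel (\<lambda>\<omega>. vmod1 (t i + N i \<omega>)))"
    by (subst (asm) indep_vars_iff_distr_eq_PiM'[OF I]) auto
  also have "\<dots> = (\<Pi>\<^sub>M i\<in>I. distr M borel (N i))"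
  proof (rule PiM_cong[OF refl])
    fix i assume i: "i \<in> I"
    have "distr M borel (\<lambda>\<omega>. vmod1 (t i + N i \<omega>)) = distr (distr M borel (N i)) borel (\<lambda>x. vmod1 (t i + x))"
      using i by (subst distr_distr) (auto simp: comp_def)
    then show "distr M borel (\<lambda>\<omega>. vmod1 (t i + N i \<omega>)) = distr M borel (N i)"
      by (simp add: unif[OF i] distr_uniform_half_cube_vmod1_shift)
  qed
  also have "\<dots> = distr M (PiM I (\<lambda>_. borel)) (\<lambda>\<omega>. \<lambda>i\<in>I. N i \<omega>)"
    using indep by (subst (asm) indep_vars_iff_distr_eq_PiM'[OF I]) auto
  finally show ?thesis .
qed

lemma vmod1_add_vmod1: "vmod1 (x + vmod1 y) = vmod1 (x + y)"
  using vmod1_diff_Ints[of y] by (intro vmod1_cong_Ints) simp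

text \<open>Wrapping changes each \<open>y i\<close> by an integer vector, and the coefficients are
  integers. This is where integrality of the key matrix enters.\<close>

lemma vmod1_add_int_combination:
  "vmod1 (x + (\<Sum>i\<in>I. real_of_int (c i) *\<^sub>R vmod1 (y i))) = vmod1 (x + (\<Sum>i\<in>I. real_of_int (c i) *\<^sub>R y i))"
proof (rule vmod1_cong_Ints)
  fix j
  have "(\<Sum>i\<in>I. real_of_int (c i) * (vmod1 (y i) $ j - y i $ j)) \<in> \<int>"
    by (intro Ints_sum Ints_mult vmod1_diff_Ints) simp
  then show "(x + (\<Sum>i\<in>I. real_of_int (c i) *\<^sub>R vmod1 (y i))) $ j -
      (x + (\<Sum>i\<in>I. real_of_int (c i) *\<^sub>R y i)) $ j \<in> \<int>"
    by (simp add: right_diff_distrib sum_subtractf)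
qed

section \<open>The law of the received signal\<close>

text \<open>The secrecy core: a change of messages that keeps the sum is absorbed by a shift of the
  seeds \<open>N\<close>, which leaves their joint law unchanged.\<close>

lemma (in prob_space) distr_masked_sum_cong:
  fixes N :: "nat \<Rightarrow> 'a \<Rightarrow> real^'d" and v v' :: "nat \<Rightarrow> real^'d"
  assumes K: "K \<ge> 2" and G: "any_K1_rows_full_rank K G"
    and G_colsum: "\<forall>i\<in>{1..K-1}. (\<Sum>k=1..K. G k i) = 0"
    and N_indep: "indep_vars (\<lambda>_. borel) N {1..K-1}"
    and N_unif: "\<forall>i\<in>{1..K-1}. distr M borel (N i) = uniform_measure lborel half_cube"
    and S: "\<forall>k\<in>{1..K}. \<forall>\<omega>\<in>space M. S k \<omega> = vmod1 (\<Sum>i=1..K-1. real_of_int (G k i) *\<^sub>R N i \<omega>)"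
    and sum_eq: "(\<Sum>k=1..K. v k) = (\<Sum>k=1..K. v' k)"
  shows "distr M borel (\<lambda>\<omega>. \<Sum>k=1..K. vmod1 (v k + S k \<omega>)) =
    distr M borel (\<lambda>\<omega>. \<Sum>k=1..K. vmod1 (v' k + S k \<omega>))"
proof -
  \<comment> \<open>The masked sum for the messages \<open>v'\<close> as a function of the seeds
    alone; the messages \<open>v\<close> give the same function at shifted seeds.\<close>
  define F where "F n = (\<Sum>k=1..K. vmod1 (v' k + (\<Sum>i=1..K-1. real_of_int (G k i) *\<^sub>R n i)))" for n
  let ?PN = "PiM {1..K-1} (\<lambda>_. borel) :: (nat \<Rightarrow> real^'d) measure"
  have F: "F \<in> ?PN \<rightarrow>\<^sub>M borel"
    unfolding F_def by (intro borel_measurable_sum measurable_compose[OF _ borel_measurable_vmod1]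
      borel_measurable_add borel_measurable_scaleR borel_measurable_const measurable_component_singleton)
  have [measurable]: "N i \<in> borel_measurable M" if "i \<in> {1..K-1}" for i
    using N_indep that by (auto simp: indep_vars_def)
  have "\<exists>t. \<forall>k\<in>{1..K}. (\<Sum>i=1..K-1. real_of_int (G k i) *\<^sub>R t i) = v k - v' k"
    using K sum_eq by (intro sum_zero_in_column_space[OF _ G G_colsum]) (auto simp: sum_subtractf)
  then obtain t where t: "\<And>k. k \<in> {1..K} \<Longrightarrow> (\<Sum>i=1..K-1. real_of_int (G k i) *\<^sub>R t i) = v k - v' k"
    by blast
  have "(\<Sum>k=1..K. vmod1 (v k + S k \<omega>)) = F (\<lambda>i\<in>{1..K-1}. vmod1 (t i + N i \<omega>))" if "\<omega> \<in> space M" for \<omega>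
    unfolding F_def
  proof (rule sum.cong[OF refl])
    fix k assume k: "k \<in> {1..K}"
    have "vmod1 (v k + S k \<omega>) = vmod1 (v k + (\<Sum>i=1..K-1. real_of_int (G k i) *\<^sub>R N i \<omega>))"
      using S k that by (simp add: vmod1_add_vmod1)
    also have "v k + (\<Sum>i=1..K-1. real_of_int (G k i) *\<^sub>R N i \<omega>) =
        v' k + (\<Sum>i=1..K-1. real_of_int (G k i) *\<^sub>R (t i + N i \<omega>))"
      using t[OF k] by (simp add: scaleR_add_right sum.distrib)
    also have "vmod1 \<dots> = vmod1 (v' k + (\<Sum>i=1..K-1. real_of_int (G k i) *\<^sub>R vmod1 (t i + N i \<omega>)))"
      by (rule vmod1_add_int_combination[symmetric])
    finally show "vmod1 (v k + S k \<omega>) =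
        vmod1 (v' k + (\<Sum>i=1..K-1. real_of_int (G k i) *\<^sub>R (\<lambda>i\<in>{1..K-1}. vmod1 (t i + N i \<omega>)) i))"
      by simp
  qed
  then have "distr M borel (\<lambda>\<omega>. \<Sum>k=1..K. vmod1 (v k + S k \<omega>)) =
      distr M borel (\<lambda>\<omega>. F (\<lambda>i\<in>{1..K-1}. vmod1 (t i + N i \<omega>)))"
    by (intro distr_cong) auto
  also have "\<dots> = distr (distr M ?PN (\<lambda>\<omega>. \<lambda>i\<in>{1..K-1}. vmod1 (t i + N i \<omega>))) borel F"
    by (subst distr_distr[OF F]) (auto simp: comp_def)
  also have "\<dots> = distr (distr M ?PN (\<lambda>\<omega>. \<lambda>i\<in>{1..K-1}. N i \<omega>)) borel F"
    using K N_unif by (subst distr_indep_uniform_vmod1_shift[OF _ N_indep]) auto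
  also have "\<dots> = distr M borel (\<lambda>\<omega>. F (\<lambda>i\<in>{1..K-1}. N i \<omega>))"
    by (subst distr_distr[OF F]) (auto simp: comp_def)
  also have "\<dots> = distr M borel (\<lambda>\<omega>. \<Sum>k=1..K. vmod1 (v' k + S k \<omega>))"
    using S by (intro distr_cong) (auto simp: F_def vmod1_add_vmod1)
  finally show ?thesis .
qed

section \<open>Joint densities under independent additive noise\<close>

lemma nn_integral_lborel_translation:
  fixes f :: "'a::euclidean_space \<Rightarrow> ennreal"
  assumes [measurable]: "f \<in> borel_measurable borel"
  shows "(\<integral>\<^sup>+x. f (c + x) \<partial>lborel) = (\<integral>\<^sup>+x. f x \<partial>lborel)"
proof -
  have "(\<integral>\<^sup>+x. f x \<partial>lborel) = (\<integral>\<^sup>+x. f x \<partial>distr lborel borel ((+) c))"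
    by (simp add: lborel_distr_plus)
  also have "\<dots> = (\<integral>\<^sup>+x. f (c + x) \<partial>lborel)"
    by (rule nn_integral_distr) auto
  finally show ?thesis by simp
qed

text \<open>For fixed \<open>v\<close> and \<open>s\<close> the output has the noise density
  translated by \<open>\<Psi> v s\<close>. Averaging over \<open>s\<close> gives the conditional
  density given \<open>v\<close>, and the last hypothesis says that it depends on \<open>v\<close>
  only through \<open>\<sigma> v\<close>.\<close>

lemma (in prob_space) distr_additive_noise:
  fixes z :: "'a \<Rightarrow> 'e::euclidean_space" and g :: "'e \<Rightarrow> 'w \<Rightarrow> ennreal"
  assumes [measurable]: "V \<in> M \<rightarrow>\<^sub>M MV" "S \<in> M \<rightarrow>\<^sub>M MT" "z \<in> borel_measurable M"
      "case_prod \<Psi> \<in> MV \<Otimes>\<^sub>M MT \<rightarrow>\<^sub>M borel" "\<sigma> \<in> MV \<rightarrow>\<^sub>M U"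
      "\<phi> \<in> borel_measurable borel" "case_prod g \<in> borel_measurable (borel \<Otimes>\<^sub>M U)"
    and VS: "distr M (MV \<Otimes>\<^sub>M MT) (\<lambda>\<omega>. (V \<omega>, S \<omega>)) = distr M MV V \<Otimes>\<^sub>M distr M MT S"
    and zVS: "distr M (borel \<Otimes>\<^sub>M (MV \<Otimes>\<^sub>M MT)) (\<lambda>\<omega>. (z \<omega>, V \<omega>, S \<omega>)) =
      distr M borel z \<Otimes>\<^sub>M distr M (MV \<Otimes>\<^sub>M MT) (\<lambda>\<omega>. (V \<omega>, S \<omega>))"
    and z: "distr M borel z = density lborel \<phi>"
    and g: "\<And>v y. v \<in> space MV \<Longrightarrow> (\<integral>\<^sup>+s. \<phi> (y - \<Psi> v s) \<partial>distr M MT S) = g y (\<sigma> v)"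
  shows "distr M (borel \<Otimes>\<^sub>M (MV \<Otimes>\<^sub>M U)) (\<lambda>\<omega>. (\<Psi> (V \<omega>) (S \<omega>) + z \<omega>, V \<omega>, \<sigma> (V \<omega>))) =
    density (lborel \<Otimes>\<^sub>M distr M (MV \<Otimes>\<^sub>M U) (\<lambda>\<omega>. (V \<omega>, \<sigma> (V \<omega>)))) (\<lambda>(y, v, w). g y w)"
    (is "?L = ?R")
proof (rule measure_eqI)
  fix A assume "A \<in> sets ?L"
  then have A[measurable]: "A \<in> sets (borel \<Otimes>\<^sub>M (MV \<Otimes>\<^sub>M U))" by simp
  define LV where "LV = distr M MV V"
  define LS where "LS = distr M MT S"
  define LVU where "LVU = distr M (MV \<Otimes>\<^sub>M U) (\<lambda>\<omega>. (V \<omega>, \<sigma> (V \<omega>)))"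
  have [measurable_cong]: "sets LV = sets MV" "sets LS = sets MT" "sets LVU = sets (MV \<Otimes>\<^sub>M U)"
    by (simp_all add: LV_def LS_def LVU_def)
  interpret LV: prob_space LV unfolding LV_def by (rule prob_space_distr) simp
  interpret LS: prob_space LS unfolding LS_def by (rule prob_space_distr) simp
  interpret LVU: prob_space LVU unfolding LVU_def by (rule prob_space_distr) simp
  interpret Lz: prob_space "density lborel \<phi>" unfolding z[symmetric] by (rule prob_space_distr) simp
  interpret VS: pair_prob_space LV LS ..
  interpret zVS: pair_sigma_finite "density lborel \<phi>" "LV \<Otimes>\<^sub>M LS" ..
  interpret yS: pair_sigma_finite lborel LS ..
  interpret yVU: pair_sigma_finite lborel LVU ..
  have joint: "distr M (borel \<Otimes>\<^sub>M (MV \<Otimes>\<^sub>M MT)) (\<lambda>\<omega>. (z \<omega>, V \<omega>, S \<omega>)) = density lborel \<phi> \<Otimes>\<^sub>M (LV \<Otimes>\<^sub>M LS)"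
    unfolding zVS VS z LV_def LS_def ..
  have "emeasure ?L A = (\<integral>\<^sup>+\<omega>. indicator A (\<Psi> (V \<omega>) (S \<omega>) + z \<omega>, V \<omega>, \<sigma> (V \<omega>)) \<partial>M)"
    by (simp add: nn_integral_distr flip: nn_integral_indicator)
  also have "\<dots> = (\<integral>\<^sup>+(\<zeta>, v, s). indicator A (\<Psi> v s + \<zeta>, v, \<sigma> v) \<partial>(density lborel \<phi> \<Otimes>\<^sub>M (LV \<Otimes>\<^sub>M LS)))"
    unfolding joint[symmetric] by (subst nn_integral_distr) auto
  also have "\<dots> = (\<integral>\<^sup>+(v, s). \<integral>\<^sup>+\<zeta>. indicator A (\<Psi> v s + \<zeta>, v, \<sigma> v) \<partial>density lborel \<phi> \<partial>(LV \<Otimes>\<^sub>M LS))"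
    by (subst zVS.nn_integral_snd[symmetric]) (auto simp: case_prod_unfold)
  also have "\<dots> = (\<integral>\<^sup>+v. \<integral>\<^sup>+s. \<integral>\<^sup>+\<zeta>. indicator A (\<Psi> v s + \<zeta>, v, \<sigma> v) \<partial>density lborel \<phi> \<partial>LS \<partial>LV)"
    by (subst LS.nn_integral_fst[symmetric]) auto
  also have "\<dots> = (\<integral>\<^sup>+v. \<integral>\<^sup>+y. g y (\<sigma> v) * indicator A (y, v, \<sigma> v) \<partial>lborel \<partial>LV)"
  proof (rule nn_integral_cong)
    fix v assume "v \<in> space LV"
    then have v[measurable]: "v \<in> space MV" by (simp add: LV_def)
    have "(\<integral>\<^sup>+s. \<integral>\<^sup>+\<zeta>. indicator A (\<Psi> v s + \<zeta>, v, \<sigma> v) \<partial>density lborel \<phi> \<partial>LS) =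
        (\<integral>\<^sup>+s. \<integral>\<^sup>+y. \<phi> (y - \<Psi> v s) * indicator A (y, v, \<sigma> v) \<partial>lborel \<partial>LS)"
    proof (rule nn_integral_cong)
      fix s assume "s \<in> space LS"
      have "(\<integral>\<^sup>+\<zeta>. indicator A (\<Psi> v s + \<zeta>, v, \<sigma> v) \<partial>density lborel \<phi>) =
          (\<integral>\<^sup>+\<zeta>. \<phi> (\<Psi> v s + \<zeta> - \<Psi> v s) * indicator A (\<Psi> v s + \<zeta>, v, \<sigma> v) \<partial>lborel)"
        by (subst nn_integral_density) auto
      \<comment> \<open>Substituting y for the noisy output moves the dependence on \<open>s\<close>
        out of the indicator and into the density.\<close>
      also have "\<dots> = (\<integral>\<^sup>+y. \<phi> (y - \<Psi> v s) * indicator A (y, v, \<sigma> v) \<partial>lborel)"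
        by (rule nn_integral_lborel_translation) auto
      finally show "(\<integral>\<^sup>+\<zeta>. indicator A (\<Psi> v s + \<zeta>, v, \<sigma> v) \<partial>density lborel \<phi>) =
        (\<integral>\<^sup>+y. \<phi> (y - \<Psi> v s) * indicator A (y, v, \<sigma> v) \<partial>lborel)" .
    qed
    \<comment> \<open>Swapping the integrals lets the key be averaged at a fixed output.\<close>
    also have "\<dots> = (\<integral>\<^sup>+y. \<integral>\<^sup>+s. \<phi> (y - \<Psi> v s) * indicator A (y, v, \<sigma> v) \<partial>LS \<partial>lborel)"
      by (rule yS.Fubini') measurable
    also have "\<dots> = (\<integral>\<^sup>+y. g y (\<sigma> v) * indicator A (y, v, \<sigma> v) \<partial>lborel)"
      by (subst nn_integral_multc) (auto simp: g[OF v, folded LS_def])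
    finally show "(\<integral>\<^sup>+s. \<integral>\<^sup>+\<zeta>. indicator A (\<Psi> v s + \<zeta>, v, \<sigma> v) \<partial>density lborel \<phi> \<partial>LS) =
      (\<integral>\<^sup>+y. g y (\<sigma> v) * indicator A (y, v, \<sigma> v) \<partial>lborel)" .
  qed
  also have "\<dots> = (\<integral>\<^sup>+u. \<integral>\<^sup>+y. g y (snd u) * indicator A (y, u) \<partial>lborel \<partial>LVU)"
    unfolding LV_def LVU_def by (simp add: nn_integral_distr)
  also have "\<dots> = (\<integral>\<^sup>+p. (case p of (y, v, w) \<Rightarrow> g y w) * indicator A p \<partial>(lborel \<Otimes>\<^sub>M LVU))"
    by (subst yVU.nn_integral_snd[symmetric]) (auto simp: case_prod_unfold)
  also have "\<dots> = emeasure ?R A"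
    unfolding LVU_def[symmetric] by (rule emeasure_density[symmetric]) auto
  finally show "emeasure ?L A = emeasure ?R A" .
qed simp

text \<open>Turns independence of the generated sigma-algebras into a product law; agreement on
  rectangles suffices.\<close>

lemma (in prob_space) indep_rv_distr:
  assumes "indep_rv M MA X MB Y"
  shows "X \<in> M \<rightarrow>\<^sub>M MA" "Y \<in> M \<rightarrow>\<^sub>M MB"
    "distr M (MA \<Otimes>\<^sub>M MB) (\<lambda>\<omega>. (X \<omega>, Y \<omega>)) = distr M MA X \<Otimes>\<^sub>M distr M MB Y"
proof -
  show [measurable]: "X \<in> M \<rightarrow>\<^sub>M MA" "Y \<in> M \<rightarrow>\<^sub>M MB"
    using assms by (simp_all add: indep_rv_def)
  interpret X: prob_space "distr M MA X" by (rule prob_space_distr) simp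
  interpret Y: prob_space "distr M MB Y" by (rule prob_space_distr) simp
  have "distr M MA X \<Otimes>\<^sub>M distr M MB Y = distr M (MA \<Otimes>\<^sub>M MB) (\<lambda>\<omega>. (X \<omega>, Y \<omega>))"
  proof (rule pair_measure_eqI)
    fix A B assume "A \<in> sets (distr M MA X)" "B \<in> sets (distr M MB Y)"
    then have [measurable]: "A \<in> sets MA" "B \<in> sets MB" by auto
    have "indep_set (sets (vimage_algebra (space M) X MA)) (sets (vimage_algebra (space M) Y MB))"
      using assms by (simp add: indep_rv_def)
    then have "prob ((X -` A \<inter> space M) \<inter> (Y -` B \<inter> space M)) = prob (X -` A \<inter> space M) * prob (Y -` B \<inter> space M)"
      by (rule indep_setD) (auto intro: in_vimage_algebra)
    moreover have "(\<lambda>\<omega>. (X \<omega>, Y \<omega>)) -` (A \<times> B) \<inter> space M = (X -` A \<inter> space M) \<inter> (Y -` B \<inter> space M)"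
      by auto
    ultimately show "emeasure (distr M MA X) A * emeasure (distr M MB Y) B =
        emeasure (distr M (MA \<Otimes>\<^sub>M MB) (\<lambda>\<omega>. (X \<omega>, Y \<omega>))) (A \<times> B)"
      by (simp add: emeasure_distr emeasure_eq_measure ennreal_mult)
  qed (auto simp: X.sigma_finite_measure_axioms Y.sigma_finite_measure_axioms)
  then show "distr M (MA \<Otimes>\<^sub>M MB) (\<lambda>\<omega>. (X \<omega>, Y \<omega>)) = distr M MA X \<Otimes>\<^sub>M distr M MB Y" ..
qed

section \<open>Secrecy of the masked aggregation\<close>

theorem theorem1:
  fixes M :: "'a measure"
    and K :: nat
    and G :: "nat \<Rightarrow> nat \<Rightarrow> int"
    and N :: "nat \<Rightarrow> 'a \<Rightarrow> real^'d"
    and Wk :: "nat \<Rightarrow> 'a \<Rightarrow> real^'d"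
    and z :: "'a \<Rightarrow> real^'d"
    and h :: "nat \<Rightarrow> real"
    and P N0 a :: real
    and S e x :: "nat \<Rightarrow> 'a \<Rightarrow> real^'d"
    and W y :: "'a \<Rightarrow> real^'d"
  assumes "prob_space M"
    and K: "K \<ge> 2"
    \<comment> \<open>G_S: any K-1 rows full rank, and 1^T G_S = 0\<close>
    and G_rank: "any_K1_rows_full_rank K G"
    and G_colsum: "\<forall>i\<in>{1..K-1}. (\<Sum>k=1..K. G k i) = 0"
    \<comment> \<open>N_1..N_{K-1} i.i.d. uniform on [-1/2,1/2)^D\<close>
    and N_indep: "prob_space.indep_vars M (\<lambda>_. borel) N {1..K-1}"
    and N_unif: "\<forall>i\<in>{1..K-1}. distr M borel (N i) = uniform_measure lborel half_cube"
    \<comment> \<open>secret keys\<close>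
    and S_def: "\<forall>k\<in>{1..K}. \<forall>\<omega>\<in>space M.
                  S k \<omega> = vmod1 (\<Sum>i=1..K-1. real_of_int (G k i) *\<^sub>R N i \<omega>)"
    \<comment> \<open>private messages, their sum bounded in [-a,a]^D with 0 < a < 1/2\<close>
    and Wk_rv: "\<forall>k\<in>{1..K}. Wk k \<in> borel_measurable M"
    and W_def: "\<forall>\<omega>\<in>space M. W \<omega> = (\<Sum>k=1..K. Wk k \<omega>)"
    and a: "0 < a" "a < 1/2"
    and W_bound: "\<forall>\<omega>\<in>space M. \<forall>j. \<bar>W \<omega> $ j\<bar> \<le> a"
    \<comment> \<open>messages independent of the keys\<close>
    and indep_WS: "indep_rv M
        (PiM {1..K} (\<lambda>_. borel)) (\<lambda>\<omega>. \<lambda>k\<in>{1..K}. Wk k \<omega>)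
        (PiM {1..K} (\<lambda>_. borel)) (\<lambda>\<omega>. \<lambda>k\<in>{1..K}. S k \<omega>)"
    \<comment> \<open>channel: P > 0, h_k nonzero, Gaussian noise N(0, N0 I_D)\<close>
    and P: "P > 0"
    and h: "\<forall>k\<in>{1..K}. h k \<noteq> 0"
    and N0: "N0 > 0"
    and z_gauss: "distr M borel z =
        density lborel (\<lambda>v. ennreal (\<Prod>j\<in>UNIV. normal_density 0 (sqrt N0) (v $ j)))"
    and indep_z: "indep_rv M borel z
        (PiM {1..K} (\<lambda>_. borel) \<Otimes>\<^sub>M PiM {1..K} (\<lambda>_. borel))
        (\<lambda>\<omega>. (\<lambda>k\<in>{1..K}. Wk k \<omega>, \<lambda>k\<in>{1..K}. S k \<omega>))"
    \<comment> \<open>encoding, transmission, reception\<close>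
    and e_def: "\<forall>k\<in>{1..K}. \<forall>\<omega>\<in>space M. e k \<omega> = vmod1 (Wk k \<omega> + S k \<omega>)"
    and x_def: "\<forall>k\<in>{1..K}. \<forall>\<omega>\<in>space M. x k \<omega> = (sqrt P / h k) *\<^sub>R e k \<omega>"
    and y_def: "\<forall>\<omega>\<in>space M. y \<omega> = (\<Sum>k=1..K. h k *\<^sub>R x k \<omega>) + z \<omega>"
  shows "prob_space.conditional_mutual_information M 2
           borel (PiM {1..K} (\<lambda>_. borel)) borel
           y (\<lambda>\<omega>. \<lambda>k\<in>{1..K}. Wk k \<omega>) W = 0"
proof -
  interpret prob_space M by fact
  define PM where "PM = (PiM {1..K} (\<lambda>_. borel) :: (nat \<Rightarrow> real^'d) measure)"
  define V where "V \<omega> = (\<lambda>k\<in>{1..K}. Wk k \<omega>)" for \<omega>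
  define T where "T \<omega> = (\<lambda>k\<in>{1..K}. S k \<omega>)" for \<omega>
  \<comment> \<open>The noiseless received signal as a function of messages and keys.\<close>
  define \<Psi> where "\<Psi> v s = sqrt P *\<^sub>R (\<Sum>k=1..K. vmod1 (v k + s k))" for v s :: "nat \<Rightarrow> real^'d"
  define \<sigma> where "\<sigma> v = (\<Sum>k=1..K. v k)" for v :: "nat \<Rightarrow> real^'d"
  define \<phi> where "\<phi> v = ennreal (\<Prod>j\<in>UNIV. normal_density 0 (sqrt N0) (v $ j))" for v :: "real^'d"
  \<comment> \<open>A representative message vector with sum \<open>w\<close>: client
    \<open>K\<close> holds everything. Then \<open>g\<close> is the density of the received signal
    given the sum \<open>w\<close>, computed at this representative.\<close>
  define ref where "ref w = (\<lambda>k\<in>{1..K}. if k = K then w else 0)" for w :: "real^'d"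
  define g where "g u w = (\<integral>\<^sup>+s. \<phi> (u - \<Psi> (ref w) s) \<partial>distr M PM T)" for u w
  have z_meas[measurable]: "z \<in> borel_measurable M"
    using indep_rv_distr(1)[OF indep_z] .
  have VT_meas[measurable]: "V \<in> M \<rightarrow>\<^sub>M PM" "T \<in> M \<rightarrow>\<^sub>M PM"
    using indep_rv_distr(1,2)[OF indep_WS] by (simp_all add: V_def[abs_def] T_def[abs_def] PM_def)
  have VT: "distr M (PM \<Otimes>\<^sub>M PM) (\<lambda>\<omega>. (V \<omega>, T \<omega>)) = distr M PM V \<Otimes>\<^sub>M distr M PM T"
    using indep_rv_distr(3)[OF indep_WS] by (simp add: V_def[abs_def] T_def[abs_def] PM_def)
  have zVT: "distr M (borel \<Otimes>\<^sub>M (PM \<Otimes>\<^sub>M PM)) (\<lambda>\<omega>. (z \<omega>, V \<omega>, T \<omega>)) =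
      distr M borel z \<Otimes>\<^sub>M distr M (PM \<Otimes>\<^sub>M PM) (\<lambda>\<omega>. (V \<omega>, T \<omega>))"
    using indep_rv_distr(3)[OF indep_z] by (simp add: V_def[abs_def] T_def[abs_def] PM_def)
  have comp[measurable]: "(\<lambda>v. v k) \<in> PM \<rightarrow>\<^sub>M borel" if "k \<in> {1..K}" for k
    using that unfolding PM_def by (rule measurable_component_singleton)
  have [measurable]: "case_prod \<Psi> \<in> PM \<Otimes>\<^sub>M PM \<rightarrow>\<^sub>M borel"
    unfolding \<Psi>_def by measurable
  have [measurable]: "\<sigma> \<in> PM \<rightarrow>\<^sub>M borel"
    unfolding \<sigma>_def by measurable
  have [measurable]: "ref \<in> borel \<rightarrow>\<^sub>M PM"
    unfolding ref_def PM_def by (intro measurable_restrict) auto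
  have [measurable]: "\<phi> \<in> borel_measurable borel"
    unfolding \<phi>_def by measurable
  interpret LT: prob_space "distr M PM T" by (rule prob_space_distr) simp
  have g_meas[measurable]: "case_prod g \<in> borel_measurable (borel \<Otimes>\<^sub>M borel)"
    unfolding g_def by measurable
  have \<phi>_pos: "\<phi> v > 0" for v
    using N0 by (auto simp: \<phi>_def intro!: prod_pos normal_density_pos)
  have g_pos: "g u w > 0" for u w
  proof (rule ccontr)
    assume "\<not> g u w > 0"
    then have "g u w = 0" by simp
    then have "AE s in distr M PM T. \<phi> (u - \<Psi> (ref w) s) = 0"
      unfolding g_def by (subst (asm) nn_integral_0_iff_AE) auto
    then have "AE s in distr M PM T. False"
      by eventually_elim (use \<phi>_pos in \<open>simp add: less_le\<close>)
    then show False by simp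
  qed
  \<comment> \<open>Any \<open>v\<close> may be replaced by the representative with the same sum,
    since the average over the keys sees only the law of the masked sum.\<close>
  have g: "(\<integral>\<^sup>+s. \<phi> (u - \<Psi> v s) \<partial>distr M PM T) = g u (\<sigma> v)" if "v \<in> space PM" for u v
  proof -
    have S_meas[measurable]: "S k \<in> borel_measurable M" if "k \<in> {1..K}" for k
      using measurable_compose[OF VT_meas(2) comp[OF that]] that by (simp add: T_def)
    have law: "(\<integral>\<^sup>+s. \<phi> (u - \<Psi> v s) \<partial>distr M PM T) =
        (\<integral>\<^sup>+x. \<phi> (u - sqrt P *\<^sub>R x) \<partial>distr M borel (\<lambda>\<omega>. \<Sum>k=1..K. vmod1 (v k + S k \<omega>)))"
      if "v \<in> space PM" for v
    proof -
      have "(\<integral>\<^sup>+s. \<phi> (u - \<Psi> v s) \<partial>distr M PM T) = (\<integral>\<^sup>+\<omega>. \<phi> (u - \<Psi> v (T \<omega>)) \<partial>M)"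
        using that by (intro nn_integral_distr) auto
      also have "\<dots> = (\<integral>\<^sup>+\<omega>. \<phi> (u - sqrt P *\<^sub>R (\<Sum>k=1..K. vmod1 (v k + S k \<omega>))) \<partial>M)"
        by (simp add: \<Psi>_def T_def)
      also have "\<dots> = (\<integral>\<^sup>+x. \<phi> (u - sqrt P *\<^sub>R x) \<partial>distr M borel (\<lambda>\<omega>. \<Sum>k=1..K. vmod1 (v k + S k \<omega>)))"
        by (rule nn_integral_distr[symmetric]) auto
      finally show ?thesis .
    qed
    have "ref (\<sigma> v) \<in> space PM" by (auto simp: ref_def PM_def space_PiM)
    moreover have "(\<Sum>k=1..K. v k) = (\<Sum>k=1..K. ref (\<sigma> v) k)"
      using K by (simp add: ref_def \<sigma>_def)
    note distr_masked_sum_cong[OF K G_rank G_colsum N_indep N_unif S_def this]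
    ultimately show ?thesis
      unfolding g_def by (simp add: law that)
  qed
  \<comment> \<open>Channel inversion: each factor \<open>h k\<close> cancels the denominator in
    \<open>x k\<close>.\<close>
  have y_eq: "y \<omega> = \<Psi> (V \<omega>) (T \<omega>) + z \<omega>" if "\<omega> \<in> space M" for \<omega>
    using that h P e_def x_def y_def by (simp add: \<Psi>_def V_def T_def scaleR_sum_right)
  have W_eq: "W \<omega> = \<sigma> (V \<omega>)" if "\<omega> \<in> space M" for \<omega>
    using that W_def by (simp add: \<sigma>_def V_def)
  have [measurable]: "y \<in> borel_measurable M" "W \<in> borel_measurable M"
    by (simp_all add: y_eq W_eq cong: measurable_cong)
  have "distr M (borel \<Otimes>\<^sub>M (PM \<Otimes>\<^sub>M borel)) (\<lambda>\<omega>. (y \<omega>, V \<omega>, W \<omega>)) =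
      distr M (borel \<Otimes>\<^sub>M (PM \<Otimes>\<^sub>M borel)) (\<lambda>\<omega>. (\<Psi> (V \<omega>) (T \<omega>) + z \<omega>, V \<omega>, \<sigma> (V \<omega>)))"
    by (intro distr_cong) (auto simp: y_eq W_eq)
  also have "\<dots> = density (lborel \<Otimes>\<^sub>M distr M (PM \<Otimes>\<^sub>M borel) (\<lambda>\<omega>. (V \<omega>, \<sigma> (V \<omega>)))) (\<lambda>(u, v, w). g u w)"
    by (rule distr_additive_noise[where \<phi> = \<phi> and MT = PM])
      (auto simp: z_gauss \<phi>_def[abs_def, symmetric] VT zVT g)
  also have "distr M (PM \<Otimes>\<^sub>M borel) (\<lambda>\<omega>. (V \<omega>, \<sigma> (V \<omega>))) = distr M (PM \<Otimes>\<^sub>M borel) (\<lambda>\<omega>. (V \<omega>, W \<omega>))"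
    by (intro distr_cong) (auto simp: W_eq)
  \<comment> \<open>The received signal takes the first slot because it is the variable with a
    Lebesgue density; the messages and their sum keep an arbitrary joint law.\<close>
  finally have "conditional_mutual_information 2 borel PM borel y V W = 0"
    by (intro conditional_mutual_information_eq_0[where \<mu> = lborel and g = g])
      (auto simp: g_pos lborel.sigma_finite_measure_axioms)
  then show ?thesis by (simp add: PM_def V_def[abs_def])
qed

end
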